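(* Let $d$ be a positive integer and let $(a_n)_{n\ge1}$ be a sequence in $\mathbb{R}^d$ with $\|a_n\|\to 0$ such that $$\sum_{n=1}^\infty |\langle a_n, e\rangle|=\infty\quad\text{for all } e\in\mathbb{S}^{d-1}.$$ Then $S(a_n)$ is dense in $\mathbb{R}^d$.
   Context: $\langle\cdot,\cdot\rangle$ is the standard scalar product and $\|\cdot\|$ the Euclidean norm on $\mathbb{R}^d$; $\mathbb{S}^{d-1}$ is the unit sphere of $\mathbb{R}^d$. For a sequence $(a_n)$ in $\mathbb{R}^d$, $S(a_n)$ denotes the set of all $x\in\mathbb{R}^d$ for which there is a sign sequence $\varepsilon=(\varepsilon_n)_{n\ge1}\in\{-1,1\}^{\mathbb{N}}$ such that the partial sums of $\sum_{n=1}^\infty\varepsilon_n a_n$ converge to $x$. *)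

theory Defs
  imports "HOL-Analysis.Analysis"
begin

(* Sequences are indexed from 0, so a 0, a 1, ... stand for a_1, a_2, ... *)
definition signed_sums :: "(nat \<Rightarrow> real ^ 'd) \<Rightarrow> (real ^ 'd) set" where
  "signed_sums a =
     {x. \<exists>\<epsilon> :: nat \<Rightarrow> real. (\<forall>n. \<epsilon> n \<in> {-1, 1}) \<and> (\<lambda>n. \<epsilon> n *\<^sub>R a n) sums x}"

end

theory Submission
  imports Defs
begin

text \<open>
  Every point is a finite combination of the \<open>a n\<close> with coefficients in \<open>[-1, 1]\<close>: the set of these
  combinations is convex, and by the divergence assumption it lies in no half-space. Such coefficients
  are rounded to signs in the manner of Barany and Grinberg: for vectors in the unit ball, this
  changes every partial sum by at most \<open>2 d\<close>. Rounding is applied to the normalised vectors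
  \<open>a n / \<delta> n\<close>, where \<open>\<delta> n\<close> is the supremum of \<open>norm (a m)\<close> over \<open>m \<ge> n\<close>. Summation by parts
  with the null sequence \<open>\<delta>\<close> then makes the signed series of the \<open>a n\<close> converge, with
  error at most \<open>2 d \<delta> 0\<close>. This error is arbitrarily small for a tail of the sequence.
\<close>

section \<open>Rounding of finitely many coefficients\<close>

text \<open>The family is indexed because vectors may repeat. If they do not, the image is too large
  to be independent; if two indices share a vector, their difference is already a relation.\<close>

lemma linear_relation_if_card_gt_DIM:
  fixes v :: "'i \<Rightarrow> 'a::euclidean_space"
  assumes "finite F" "card F > DIM('a)"
  obtains c :: "'i \<Rightarrow> real" and k
  where "k \<in> F" "c k \<noteq> 0" "(\<Sum>i\<in>F. c i *\<^sub>R v i) = 0"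
proof (cases "inj_on v F")
  case True
  then have "dependent (v ` F)"
    using assms by (intro dependent_biggerset) (simp_all add: card_image)
  then obtain u where u: "\<exists>x\<in>v ` F. u x \<noteq> 0" "(\<Sum>x\<in>v ` F. u x *\<^sub>R x) = 0"
    using assms(1) by (auto simp: dependent_finite)
  then obtain k where "k \<in> F" "u (v k) \<noteq> 0" by auto
  moreover have "(\<Sum>i\<in>F. u (v i) *\<^sub>R v i) = 0"
    using u(2) True by (simp add: sum.reindex)
  ultimately show thesis by (intro that[where c = "\<lambda>i. u (v i)"])
next
  case False
  then obtain i j where ij: "i \<in> F" "j \<in> F" "i \<noteq> j" "v i = v j"
    by (auto simp: inj_on_def)
  have "(\<Sum>l\<in>F. (of_bool (l = i) - of_bool (l = j)) *\<^sub>R v l)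
      = (\<Sum>l\<in>F. if l = i then v l else 0) - (\<Sum>l\<in>F. if l = j then v l else 0)"
    unfolding sum_subtractf[symmetric] by (intro sum.cong refl) (simp add: scaleR_diff_left)
  also have "\<dots> = 0"
    using ij assms(1) by simp
  finally show thesis
    using ij by (intro that[of i "\<lambda>l. of_bool (l = i) - of_bool (l = j)"]) auto
qed

text \<open>Starting from the point \<open>t\<close> of the cube, one moves in direction
  \<open>c\<close> until the first coordinate meets the boundary.\<close>

lemma move_to_face:
  fixes t c :: "'i \<Rightarrow> real"
  assumes "finite F" "k \<in> F" "c k \<noteq> 0" and t: "\<And>i. i \<in> F \<Longrightarrow> \<bar>t i\<bar> \<le> 1"
  obtains s j where "\<And>i. i \<in> F \<Longrightarrow> \<bar>t i + s * c i\<bar> \<le> 1" "j \<in> F" "\<bar>t j + s * c j\<bar> = 1"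
proof -
  define G where "G = {i \<in> F. c i \<noteq> 0}"
  \<comment> \<open>\<open>r i\<close> is the time at which coordinate \<open>i\<close> reaches
    \<open>sgn (c i)\<close>, the end of the interval towards which it moves.\<close>
  define r where "r i = (1 - sgn (c i) * t i) / \<bar>c i\<bar>" for i
  have G: "finite (r ` G)" "r ` G \<noteq> {}"
    using assms by (auto simp: G_def)
  define s where "s = Min (r ` G)"
  have "s \<in> r ` G"
    unfolding s_def using G by (rule Min_in)
  then obtain j where j: "j \<in> G" "s = r j" by auto
  have r0: "0 \<le> r i" if "i \<in> G" for i
  proof -
    have "\<bar>t i\<bar> \<le> 1" using that t by (auto simp: G_def)
    then show ?thesis
      by (auto simp: r_def sgn_if intro!: divide_nonneg_nonneg)
  qed
  have s: "0 \<le> s" using j r0 by simp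
  have "\<bar>t i + s * c i\<bar> \<le> 1" if "i \<in> F" for i
  proof (cases "c i = 0")
    case True
    then show ?thesis using t that by simp
  next
    case False
    then have "i \<in> G" using that by (simp add: G_def)
    then have "s \<le> r i" unfolding s_def using G by simp
    then have "s * \<bar>c i\<bar> \<le> 1 - sgn (c i) * t i"
      using False by (simp add: r_def field_simps)
    moreover have "0 \<le> s * \<bar>c i\<bar>" using s by simp
    moreover have "\<bar>t i\<bar> \<le> 1" using t that by simp
    ultimately show ?thesis
      using False by (auto simp: sgn_if abs_if split: if_splits)
  qed
  moreover have "\<bar>t j + s * c j\<bar> = 1"
    using j(1) unfolding j(2) r_def by (auto simp: G_def sgn_if abs_if)
  ultimately show thesis
    using that j(1) by (auto simp: G_def)
qed

text \<open>While more than \<open>DIM('a)\<close> coefficients lie strictly between the signs, a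
  linear relation among their vectors is a direction in which the sum stays constant. Following it
  to a face of the cube turns one more coefficient into a sign. Signs already reached are kept, so
  roundings can be iterated.\<close>

lemma round_all_but_DIM:
  fixes v :: "'i \<Rightarrow> 'a::euclidean_space" and t :: "'i \<Rightarrow> real"
  assumes "finite A" and "\<And>i. \<bar>t i\<bar> \<le> 1"
  shows "\<exists>t'. (\<forall>i. \<bar>t' i\<bar> \<le> 1) \<and> (\<forall>i. i \<notin> A \<or> \<bar>t i\<bar> = 1 \<longrightarrow> t' i = t i) \<and>
    (\<Sum>i\<in>A. t' i *\<^sub>R v i) = (\<Sum>i\<in>A. t i *\<^sub>R v i) \<and> card {i\<in>A. \<bar>t' i\<bar> \<noteq> 1} \<le> DIM('a)"
  using assms(2)
proof (induction "card {i\<in>A. \<bar>t i\<bar> \<noteq> 1}" arbitrary: t rule: less_induct)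
  case less
  define F where "F = {i\<in>A. \<bar>t i\<bar> \<noteq> 1}"
  have F: "finite F" "F \<subseteq> A" using assms(1) by (auto simp: F_def)
  show ?case
  proof (cases "card F \<le> DIM('a)")
    case True
    then show ?thesis using less.prems unfolding F_def by (intro exI[of _ t]) simp
  next
    case False
    then have "card F > DIM('a)" by simp
    then obtain c k where ck: "k \<in> F" "c k \<noteq> 0" "(\<Sum>i\<in>F. c i *\<^sub>R v i) = 0"
      by (rule linear_relation_if_card_gt_DIM[OF F(1)])
    then obtain s j where s: "\<And>i. i \<in> F \<Longrightarrow> \<bar>t i + s * c i\<bar> \<le> 1" "j \<in> F" "\<bar>t j + s * c j\<bar> = 1"
      using move_to_face[of F k c t] F less.prems by blast
    define u where "u i = (if i \<in> F then t i + s * c i else t i)" for i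
    have u1: "\<bar>u i\<bar> \<le> 1" for i
      using s(1) less.prems by (simp add: u_def)
    have u2: "u i = t i" if "i \<notin> A \<or> \<bar>t i\<bar> = 1" for i
      using that by (auto simp: u_def F_def)
    have "{i\<in>A. \<bar>u i\<bar> \<noteq> 1} \<subset> {i\<in>A. \<bar>t i\<bar> \<noteq> 1}"
    proof
      show "{i\<in>A. \<bar>u i\<bar> \<noteq> 1} \<subseteq> {i\<in>A. \<bar>t i\<bar> \<noteq> 1}" using u2 by fastforce
      have "\<bar>u j\<bar> = 1" using s by (simp add: u_def)
      then show "{i\<in>A. \<bar>u i\<bar> \<noteq> 1} \<noteq> {i\<in>A. \<bar>t i\<bar> \<noteq> 1}" using s(2) unfolding F_def by blast
    qed
    then have "card {i\<in>A. \<bar>u i\<bar> \<noteq> 1} < card {i\<in>A. \<bar>t i\<bar> \<noteq> 1}"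
      using assms(1) by (intro psubset_card_mono) simp_all
    from less.hyps[OF this u1] obtain t' where t': "\<forall>i. \<bar>t' i\<bar> \<le> 1"
      "\<forall>i. i \<notin> A \<or> \<bar>u i\<bar> = 1 \<longrightarrow> t' i = u i"
      "(\<Sum>i\<in>A. t' i *\<^sub>R v i) = (\<Sum>i\<in>A. u i *\<^sub>R v i)" "card {i\<in>A. \<bar>t' i\<bar> \<noteq> 1} \<le> DIM('a)"
      by blast
    have "(\<Sum>i\<in>A. u i *\<^sub>R v i) = (\<Sum>i\<in>A. t i *\<^sub>R v i + s *\<^sub>R (if i \<in> F then c i *\<^sub>R v i else 0))"
      by (intro sum.cong) (auto simp: u_def algebra_simps)
    also have "\<dots> = (\<Sum>i\<in>A. t i *\<^sub>R v i) + s *\<^sub>R (\<Sum>i\<in>A. if i \<in> F then c i *\<^sub>R v i else 0)"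
      by (simp add: sum.distrib scaleR_right.sum)
    also have "(\<Sum>i\<in>A. if i \<in> F then c i *\<^sub>R v i else 0) = (\<Sum>i\<in>F. c i *\<^sub>R v i)"
      using F(2) assms(1) by (simp add: sum.inter_restrict[symmetric] Int_absorb1)
    finally have "(\<Sum>i\<in>A. u i *\<^sub>R v i) = (\<Sum>i\<in>A. t i *\<^sub>R v i)"
      using ck(3) by simp
    then show ?thesis
      using t' u2 by (intro exI[of _ t']) metis
  qed
qed

section \<open>Rounding along an infinite sequence\<close>

text \<open>At stage \<open>n\<close> the sum of the first \<open>n\<close> terms is still exact and
  at most \<open>DIM('a)\<close> of their coefficients are undecided. Each of these is later changed
  by at most 2, which gives the bound.\<close>

lemma round_prefixes:
  fixes v :: "nat \<Rightarrow> 'a::euclidean_space" and t :: "nat \<Rightarrow> real"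
  assumes v: "\<And>i. norm (v i) \<le> 1" and t: "\<And>i. \<bar>t i\<bar> \<le> 1"
  obtains e :: "nat \<Rightarrow> real" where "\<And>i. e i \<in> {-1, 1}"
    "\<And>n. norm (\<Sum>i<n. (e i - t i) *\<^sub>R v i) \<le> 2 * DIM('a)"
proof -
  define P where "P n u \<longleftrightarrow> (\<forall>i. \<bar>u i\<bar> \<le> 1) \<and> (\<forall>i\<ge>n. u i = t i) \<and>
    (\<Sum>i<n. u i *\<^sub>R v i) = (\<Sum>i<n. t i *\<^sub>R v i) \<and> card {i. i < n \<and> \<bar>u i\<bar> \<noteq> 1} \<le> DIM('a)"
    for n and u :: "nat \<Rightarrow> real"
  have "\<exists>f. \<forall>n. P n (f n) \<and> (\<forall>i. \<bar>f n i\<bar> = 1 \<longrightarrow> f (Suc n) i = f n i)"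
  proof (rule dependent_nat_choice)
    show "\<exists>u. P 0 u" using t by (intro exI[of _ t]) (simp add: P_def)
  next
    \<comment> \<open>The new index \<open>n\<close> enters with its original coefficient
      \<open>t n\<close> and is rounded together with the indices left undecided so far.\<close>
    fix u n assume u: "P n u"
    then have "\<bar>u i\<bar> \<le> 1" for i by (simp add: P_def)
    from round_all_but_DIM[of "{..<Suc n}" u v, OF finite_lessThan this]
    obtain u' where u': "\<forall>i. \<bar>u' i\<bar> \<le> 1" "\<forall>i. i \<notin> {..<Suc n} \<or> \<bar>u i\<bar> = 1 \<longrightarrow> u' i = u i"
      "(\<Sum>i<Suc n. u' i *\<^sub>R v i) = (\<Sum>i<Suc n. u i *\<^sub>R v i)"
      "card {i\<in>{..<Suc n}. \<bar>u' i\<bar> \<noteq> 1} \<le> DIM('a)"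
      by blast
    have "(\<Sum>i<Suc n. u i *\<^sub>R v i) = (\<Sum>i<Suc n. t i *\<^sub>R v i)"
      using u by (simp add: P_def)
    moreover have "u' i = t i" if "Suc n \<le> i" for i
      using u u'(2) that by (simp add: P_def)
    ultimately have "P (Suc n) u'"
      unfolding P_def using u'(1,3,4) by simp
    with u'(2) show "\<exists>u'. P (Suc n) u' \<and> (\<forall>i. \<bar>u i\<bar> = 1 \<longrightarrow> u' i = u i)"
      by blast
  qed
  then obtain f where P: "\<And>n. P n (f n)"
    and frozen: "\<And>n i. \<bar>f n i\<bar> = 1 \<Longrightarrow> f (Suc n) i = f n i" by blast
  have stable: "f m i = f n i" if "n \<le> m" "\<bar>f n i\<bar> = 1" for m n i
    using that by (induction m rule: dec_induct) (simp_all add: frozen)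
  \<comment> \<open>Coordinates that are never rounded get the arbitrary sign \<open>1\<close>.\<close>
  define e where "e i = (if \<exists>n. \<bar>f n i\<bar> = 1 then f (LEAST n. \<bar>f n i\<bar> = 1) i else 1)" for i
  have e_eq: "e i = f n i" if "\<bar>f n i\<bar> = 1" for n i
    using stable[OF Least_le[of "\<lambda>n. \<bar>f n i\<bar> = 1", OF that]
        LeastI[of "\<lambda>n. \<bar>f n i\<bar> = 1", OF that]] that
    by (auto simp: e_def)
  have e: "e i \<in> {-1, 1}" for i
  proof (cases "\<exists>n. \<bar>f n i\<bar> = 1")
    case True
    then obtain n where n: "\<bar>f n i\<bar> = 1" by blast
    then show ?thesis unfolding e_eq[OF n] by (auto simp: abs_if split: if_splits)
  qed (simp add: e_def)
  have "norm (\<Sum>i<n. (e i - t i) *\<^sub>R v i) \<le> 2 * DIM('a)" for n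
  proof -
    \<comment> \<open>Outside \<open>F\<close> the signs are final at stage \<open>n\<close>, so
      only the terms in \<open>F\<close> contribute to the error.\<close>
    define F where "F = {i. i < n \<and> \<bar>f n i\<bar> \<noteq> 1}"
    have "(\<Sum>i<n. (e i - t i) *\<^sub>R v i) = (\<Sum>i<n. (e i - f n i) *\<^sub>R v i)"
      using P[of n] by (simp add: P_def scaleR_diff_left sum_subtractf)
    also have "\<dots> = (\<Sum>i\<in>F. (e i - f n i) *\<^sub>R v i)"
      by (intro sum.mono_neutral_right) (auto simp: F_def e_eq)
    also have "norm \<dots> \<le> of_nat (card F) * 2"
    proof (rule sum_norm_bound)
      fix i
      have "\<bar>f n i\<bar> \<le> 1" using P[of n] by (simp add: P_def)
      then have "\<bar>e i - f n i\<bar> \<le> 2" using e[of i] by auto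
      then have "\<bar>e i - f n i\<bar> * norm (v i) \<le> 2 * 1" using v by (intro mult_mono) auto
      then show "norm ((e i - f n i) *\<^sub>R v i) \<le> 2" by simp
    qed
    also have "\<dots> \<le> 2 * DIM('a)"
      using P[of n] by (simp add: P_def F_def)
    finally show ?thesis .
  qed
  with e show thesis by (rule that)
qed

section \<open>From bounded partial sums to convergence\<close>

text \<open>Summation by parts leaves a boundary term tending to 0 and a series dominated by the
  telescoping series of \<open>K * (\<delta> n - \<delta> (Suc n))\<close>, whose sum
  \<open>K * \<delta> 0\<close> bounds the limit.\<close>

lemma Dirichlet_test:
  fixes u :: "nat \<Rightarrow> 'a::banach" and \<delta> :: "nat \<Rightarrow> real" and K :: real
  assumes \<delta>: "decseq \<delta>" "\<delta> \<longlonglongrightarrow> 0" and K: "\<And>n. norm (\<Sum>i<n. u i) \<le> K"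
  obtains z where "(\<lambda>n. \<delta> n *\<^sub>R u n) sums z" "norm z \<le> K * \<delta> 0"
proof -
  define U where "U n = (\<Sum>i<n. u i)" for n
  define w where "w n = (\<delta> n - \<delta> (Suc n)) *\<^sub>R U (Suc n)" for n
  have abel: "(\<Sum>n<N. \<delta> n *\<^sub>R u n) = \<delta> N *\<^sub>R U N + (\<Sum>n<N. w n)" for N
    by (induction N) (simp_all add: w_def U_def algebra_simps)
  have tele: "(\<lambda>n. K * (\<delta> n - \<delta> (Suc n))) sums (K * \<delta> 0)"
    using sums_mult[OF telescope_sums'[OF \<delta>(2)], of K] by simp
  have wK: "norm (w n) \<le> K * (\<delta> n - \<delta> (Suc n))" for n
    using mult_left_mono[OF K[of "Suc n"], of "\<delta> n - \<delta> (Suc n)"] decseq_SucD[OF \<delta>(1), of n]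
    by (simp add: w_def U_def mult.commute)
  have w: "summable w"
    using sums_summable[OF tele] wK by (rule summable_comparison_test')
  have "(\<lambda>N. \<delta> N *\<^sub>R U N) \<longlonglongrightarrow> 0"
  proof (rule Lim_null_comparison)
    show "(\<lambda>N. \<bar>\<delta> N\<bar> * K) \<longlonglongrightarrow> 0"
      by (rule tendsto_mult_left_zero) (use \<delta>(2) in \<open>simp add: tendsto_rabs_zero\<close>)
    show "\<forall>\<^sub>F N in sequentially. norm (\<delta> N *\<^sub>R U N) \<le> \<bar>\<delta> N\<bar> * K"
      using K by (simp add: U_def mult_left_mono)
  qed
  then have "(\<lambda>n. \<delta> n *\<^sub>R u n) sums suminf w"
    using tendsto_add[OF _ summable_LIMSEQ[OF w]] by (force simp: sums_def abel)
  moreover have "norm (suminf w) \<le> K * \<delta> 0"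
    using norm_suminf_le[OF wK sums_summable[OF tele]] sums_unique[OF tele]
    by simp
  ultimately show thesis by (rule that)
qed

lemma null_sequence_decreasing_majorant:
  fixes f :: "nat \<Rightarrow> real"
  assumes "f \<longlonglongrightarrow> 0" "\<And>n. f n \<le> C"
  obtains \<delta> where "decseq \<delta>" "\<delta> \<longlonglongrightarrow> 0" "\<And>n. f n \<le> \<delta> n" "\<delta> 0 \<le> C"
proof -
  define \<delta> where "\<delta> n = (SUP m\<in>{n..}. f m)" for n
  have bdd: "bdd_above (f ` A)" for A
    using assms(2) by (intro bdd_aboveI2[where M = C])
  have le: "f m \<le> \<delta> n" if "n \<le> m" for m n
    unfolding \<delta>_def using that by (intro cSUP_upper bdd) simp
  have "decseq \<delta>"
    unfolding \<delta>_def by (intro antimonoI cSUP_subset_mono bdd) auto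
  moreover have "\<delta> \<longlonglongrightarrow> 0"
  proof (rule LIMSEQ_I)
    fix r :: real assume "0 < r"
    \<comment> \<open>Half of \<open>r\<close> is used because passing to the supremum only
      preserves non-strict bounds.\<close>
    then obtain N where N: "\<And>n. N \<le> n \<Longrightarrow> \<bar>f n\<bar> < r / 2"
      using LIMSEQ_D[OF assms(1), of "r / 2"] by auto
    have "\<bar>\<delta> n\<bar> < r" if "N \<le> n" for n
    proof -
      have "\<delta> n \<le> r / 2"
        unfolding \<delta>_def
      proof (rule cSUP_least)
        fix m assume "m \<in> {n..}"
        then show "f m \<le> r / 2" using N[of m] that by simp
      qed simp
      moreover have "- (r / 2) < \<delta> n"
        using le[of n n] N[OF that] by simp
      ultimately show ?thesis using \<open>0 < r\<close> by simp
    qed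
    then show "\<exists>N. \<forall>n\<ge>N. norm (\<delta> n - 0) < r" by auto
  qed
  moreover have "\<delta> 0 \<le> C"
    unfolding \<delta>_def using assms(2) by (intro cSUP_least) auto
  ultimately show thesis
    using le by (intro that) simp_all
qed

text \<open>Only the difference of the two series is claimed to converge. Its bound is proportional
  to \<open>C\<close>, hence small when applied to a late tail.\<close>

lemma round_series:
  fixes a :: "nat \<Rightarrow> 'a::euclidean_space" and t :: "nat \<Rightarrow> real" and C :: real
  assumes lim: "(\<lambda>n. norm (a n)) \<longlonglongrightarrow> 0" and C: "\<And>n. norm (a n) \<le> C"
    and t: "\<And>n. \<bar>t n\<bar> \<le> 1"
  obtains e :: "nat \<Rightarrow> real" and z where "\<And>n. e n \<in> {-1, 1}"
    "(\<lambda>n. (e n - t n) *\<^sub>R a n) sums z" "norm z \<le> 2 * DIM('a) * C"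
proof -
  obtain \<delta> where \<delta>: "decseq \<delta>" "\<delta> \<longlonglongrightarrow> 0" "\<And>n. norm (a n) \<le> \<delta> n" "\<delta> 0 \<le> C"
    using null_sequence_decreasing_majorant[OF lim C] by blast
  define v where "v n = a n /\<^sub>R \<delta> n" for n
  have \<delta>0: "0 \<le> \<delta> n" for n
    using order_trans[OF norm_ge_zero \<delta>(3)] .
  have v: "norm (v n) \<le> 1" for n
    \<comment> \<open>If \<open>\<delta> n = 0\<close>, then \<open>v n = 0\<close> by the
      convention for division by zero; no information is lost, since \<open>a n = 0\<close> as
      well.\<close>
    using \<delta>(3)[of n] \<delta>0[of n] by (cases "\<delta> n = 0") (auto simp: v_def field_simps)
  then obtain e where e: "\<And>i. e i \<in> {-1, 1}"
    "\<And>n. norm (\<Sum>i<n. (e i - t i) *\<^sub>R v i) \<le> 2 * DIM('a)"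
    by (rule round_prefixes[of v t, OF _ t]) blast
  obtain z where z: "(\<lambda>n. \<delta> n *\<^sub>R ((e n - t n) *\<^sub>R v n)) sums z" "norm z \<le> 2 * DIM('a) * \<delta> 0"
    using Dirichlet_test[OF \<delta>(1,2) e(2)] by blast
  have "\<delta> n *\<^sub>R ((e n - t n) *\<^sub>R v n) = (e n - t n) *\<^sub>R a n" for n
    using \<delta>(3)[of n] by (cases "\<delta> n = 0") (simp_all add: v_def)
  moreover have "norm z \<le> 2 * DIM('a) * C"
    by (rule order_trans[OF z(2) mult_left_mono[OF \<delta>(4)]]) simp
  ultimately show thesis
    using e(1) z(1) by (intro that) simp_all
qed

section \<open>Exact representation with coefficients in \<open>[-1, 1]\<close>\<close>

text \<open>A point outside the convex set \<open>Z\<close> would give a linear functional bounded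
  above on \<open>Z\<close>, and hence a direction \<open>e\<close> in which the series of
  \<open>\<bar>a n \<bullet> e\<bar>\<close> is finite.\<close>

lemma bounded_coefficient_representation:
  fixes a :: "nat \<Rightarrow> 'a::euclidean_space"
  assumes "\<forall>e \<in> sphere 0 1. (\<Sum>n. ennreal \<bar>a n \<bullet> e\<bar>) = \<infinity>"
  obtains t :: "nat \<Rightarrow> real" where "\<And>n. \<bar>t n\<bar> \<le> 1" "(\<lambda>n. t n *\<^sub>R a n) sums y"
proof -
  \<comment> \<open>Extending the coefficients by zero lets two combinations be rewritten over a
    common range, and turns a combination into a series at the end.\<close>
  define Z where "Z = {\<Sum>n<M. t n *\<^sub>R a n | (t :: nat \<Rightarrow> real) M.
    (\<forall>n. \<bar>t n\<bar> \<le> 1) \<and> (\<forall>n\<ge>M. t n = 0)}"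
  have ZI: "(\<Sum>n<M. t n *\<^sub>R a n) \<in> Z" if "\<And>n. n < M \<Longrightarrow> \<bar>t n\<bar> \<le> 1" for t M
  proof -
    have "(\<Sum>n<M. t n *\<^sub>R a n) = (\<Sum>n<M. (if n < M then t n else 0) *\<^sub>R a n)"
      by (intro sum.cong) auto
    with that show ?thesis
      unfolding Z_def mem_Collect_eq
      by (intro exI[of _ "\<lambda>n. if n < M then t n else 0"] exI[of _ M]) auto
  qed
  have "convex Z"
  proof (rule convexI)
    fix p q and \<alpha> \<beta> :: real
    assume "p \<in> Z" "q \<in> Z" and ab: "0 \<le> \<alpha>" "0 \<le> \<beta>" "\<alpha> + \<beta> = 1"
    then obtain t M s N where p: "p = (\<Sum>n<M. t n *\<^sub>R a n)" "\<And>n. \<bar>t n\<bar> \<le> 1" "\<And>n. n \<ge> M \<Longrightarrow> t n = 0"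
      and q: "q = (\<Sum>n<N. s n *\<^sub>R a n)" "\<And>n. \<bar>s n\<bar> \<le> 1" "\<And>n. n \<ge> N \<Longrightarrow> s n = 0"
      unfolding Z_def by blast
    define L where "L = max M N"
    have "p = (\<Sum>n<L. t n *\<^sub>R a n)"
      unfolding p(1) by (rule sum.mono_neutral_left) (auto simp: L_def p(3))
    moreover have "q = (\<Sum>n<L. s n *\<^sub>R a n)"
      unfolding q(1) by (rule sum.mono_neutral_left) (auto simp: L_def q(3))
    ultimately have "\<alpha> *\<^sub>R p + \<beta> *\<^sub>R q = (\<Sum>n<L. (\<alpha> * t n + \<beta> * s n) *\<^sub>R a n)"
      by (simp add: scaleR_add_left sum.distrib scaleR_right.sum)
    moreover have "\<bar>\<alpha> * t n + \<beta> * s n\<bar> \<le> 1" for n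
    proof -
      have "\<bar>\<alpha> * t n + \<beta> * s n\<bar> \<le> \<alpha> * \<bar>t n\<bar> + \<beta> * \<bar>s n\<bar>"
        using ab abs_triangle_ineq[of "\<alpha> * t n" "\<beta> * s n"] by (simp add: abs_mult)
      also have "\<dots> \<le> 1"
        using ab p(2) q(2) by (intro convex_bound_le)
      finally show ?thesis .
    qed
    ultimately show "\<alpha> *\<^sub>R p + \<beta> *\<^sub>R q \<in> Z" using ZI by simp
  qed
  have "y \<in> Z"
  proof (rule ccontr)
    assume "y \<notin> Z"
    moreover have "Z \<noteq> {}" using ZI[of 0] by auto
    ultimately obtain c b where c: "c \<noteq> 0" "\<And>z. z \<in> Z \<Longrightarrow> c \<bullet> z \<le> b"
      using separating_hyperplane_sets[OF \<open>convex Z\<close> convex_singleton[of y]] by auto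
    define e where "e = c /\<^sub>R norm c"
    have "(\<Sum>n. ennreal \<bar>a n \<bullet> e\<bar>) \<le> ennreal (b / norm c)"
    proof (rule suminf_le_const)
      fix M
      \<comment> \<open>These coefficients maximise \<open>c\<close> over the combinations of the
        first \<open>M\<close> vectors: each term contributes
        \<open>\<bar>a n \<bullet> c\<bar>\<close>.\<close>
      have "c \<bullet> (\<Sum>n<M. sgn (a n \<bullet> c) *\<^sub>R a n) \<le> b"
        by (intro c(2) ZI) (simp add: abs_sgn_eq)
      then have "(\<Sum>n<M. \<bar>a n \<bullet> c\<bar>) \<le> b"
        by (simp add: inner_sum_right inner_commute[of c] abs_sgn mult.commute)
      moreover have "(\<Sum>n<M. \<bar>a n \<bullet> e\<bar>) = (\<Sum>n<M. \<bar>a n \<bullet> c\<bar>) / norm c"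
        unfolding sum_divide_distrib by (simp add: e_def abs_mult divide_inverse mult.commute)
      ultimately have "(\<Sum>n<M. \<bar>a n \<bullet> e\<bar>) \<le> b / norm c"
        by (simp add: divide_right_mono)
      then show "(\<Sum>n<M. ennreal \<bar>a n \<bullet> e\<bar>) \<le> ennreal (b / norm c)"
        by (simp add: sum_ennreal ennreal_leI)
    qed simp
    moreover have "e \<in> sphere 0 1" using c(1) by (simp add: e_def)
    ultimately show False using assms by (metis ennreal_neq_top infinity_ennreal_def top.extremum_uniqueI)
  qed
  then obtain t M where t: "y = (\<Sum>n<M. t n *\<^sub>R a n)" "\<And>n. \<bar>t n\<bar> \<le> 1" "\<And>n. n \<ge> M \<Longrightarrow> t n = 0"
    unfolding Z_def by blast
  have "(\<lambda>n. t n *\<^sub>R a n) sums y"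
    unfolding t(1) by (rule sums_finite) (auto simp: t(3))
  with t(2) show thesis by (rule that)
qed

section \<open>Passing to a tail and conclusion\<close>

text \<open>The first \<open>N\<close> terms all receive the sign 1.\<close>

lemma signed_sums_shift:
  assumes "x \<in> signed_sums (\<lambda>n. a (n + N))"
  shows "x + (\<Sum>n<N. a n) \<in> signed_sums a"
proof -
  obtain e :: "nat \<Rightarrow> real" where e: "\<And>n. e n \<in> {-1, 1}" "(\<lambda>n. e n *\<^sub>R a (n + N)) sums x"
    using assms unfolding signed_sums_def by blast
  define e' where "e' n = (if n < N then 1 else e (n - N))" for n
  have "(\<lambda>n. e' n *\<^sub>R a n) sums (x + (\<Sum>n<N. e' n *\<^sub>R a n))"
    using e(2) by (subst sums_iff_shift[symmetric]) (simp add: e'_def)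
  moreover have "(\<Sum>n<N. e' n *\<^sub>R a n) = (\<Sum>n<N. a n)"
    by (intro sum.cong) (simp_all add: e'_def)
  moreover have "\<forall>n. e' n \<in> {-1, 1}"
    using e(1) by (simp add: e'_def)
  ultimately show ?thesis unfolding signed_sums_def by auto
qed

lemma suminf_ennreal_shift_eq_top:
  fixes f :: "nat \<Rightarrow> real"
  assumes "\<And>n. 0 \<le> f n" "(\<Sum>n. ennreal (f n)) = \<infinity>"
  shows "(\<Sum>n. ennreal (f (n + N))) = \<infinity>"
proof -
  have "(\<Sum>n. ennreal (f (n + N))) + (\<Sum>n<N. ennreal (f n)) = \<infinity>"
    using suminf_offset[of "\<lambda>n. ennreal (f n)" N] assms(2) by simp
  moreover have "(\<Sum>n<N. ennreal (f n)) \<noteq> \<infinity>"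
    using assms(1) by simp
  ultimately show ?thesis by (simp add: ennreal_add_eq_top)
qed

theorem proposition4p3:
  fixes a :: "nat \<Rightarrow> real ^ 'd"
  assumes "(\<lambda>n. norm (a n)) \<longlonglongrightarrow> 0"
    and "\<forall>e \<in> sphere 0 1. (\<Sum>n. ennreal \<bar>a n \<bullet> e\<bar>) = \<infinity>"
  shows "closure (signed_sums a) = UNIV"
proof -
  have "\<exists>x\<in>signed_sums a. dist x y < r" if "0 < r" for y r
  proof -
    \<comment> \<open>The rounding error on a tail bounded by \<open>C\<close> is at most
      \<open>2 * CARD('d) * C\<close>; the summand 1 in the denominator makes this strictly less
      than \<open>r\<close>.\<close>
    define C where "C = r / (2 * CARD('d) + 1)"
    have C: "0 < C" "2 * CARD('d) * C < r"
      using that by (simp_all add: C_def field_simps add_pos_nonneg)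
    obtain N where N: "\<And>n. N \<le> n \<Longrightarrow> norm (a n) < C"
      using LIMSEQ_D[OF assms(1) C(1)] by auto
    have lim: "(\<lambda>n. norm (a (n + N))) \<longlonglongrightarrow> 0"
      using assms(1) by (rule LIMSEQ_ignore_initial_segment)
    have le: "norm (a (n + N)) \<le> C" for n
      using N[of "n + N"] by simp
    have div: "\<forall>e \<in> sphere 0 1. (\<Sum>n. ennreal \<bar>a (n + N) \<bullet> e\<bar>) = \<infinity>"
      using assms(2) by (intro ballI suminf_ennreal_shift_eq_top abs_ge_zero) (rule bspec)
    \<comment> \<open>The target is \<open>y\<close> corrected in advance by the initial terms,
      which will be added back with sign 1.\<close>
    obtain t :: "nat \<Rightarrow> real" where t: "\<And>n. \<bar>t n\<bar> \<le> 1"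
      "(\<lambda>n. t n *\<^sub>R a (n + N)) sums (y - (\<Sum>n<N. a n))"
      by (rule bounded_coefficient_representation[OF div]) blast
    obtain e z where e: "\<And>n. e n \<in> {-1, 1}" and z: "(\<lambda>n. (e n - t n) *\<^sub>R a (n + N)) sums z"
      "norm z \<le> 2 * DIM(real ^ 'd) * C"
      by (rule round_series[of _ C t, OF lim le t(1)]) blast
    \<comment> \<open>With this \<open>x\<close>, the distance from the shifted point to
      \<open>y\<close> is exactly the norm of the rounding error \<open>z\<close>.\<close>
    define x where "x = z + (y - (\<Sum>n<N. a n))"
    have "(\<lambda>n. e n *\<^sub>R a (n + N)) sums x"
      using sums_add[OF z(1) t(2)] by (simp add: x_def algebra_simps)
    with e have "x \<in> signed_sums (\<lambda>n. a (n + N))"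
      unfolding signed_sums_def by blast
    then have "x + (\<Sum>n<N. a n) \<in> signed_sums a"
      by (rule signed_sums_shift)
    moreover have "dist (x + (\<Sum>n<N. a n)) y < r"
      using z(2) C(2) by (simp add: x_def dist_norm)
    ultimately show ?thesis by blast
  qed
  then show ?thesis by (auto simp: closure_approachable)
qed

end
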